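(* Let $X,Y$ be non-empty sets and let $a$ be a function from $Y$ to $X$ that is not a bijection. Let $\operatorname{im}(a)=\{a_i:i\in I\}$ (with $i\mapsto a_i$ injective), $\lambda_i=|a_ia^{-1}|$ for $i\in I$, $\Lambda_I=\prod_{i\in I}\lambda_i$, $\alpha=\operatorname{rank}(a)=|I|$ and $\beta=|X\setminus\operatorname{im}(a)|$. Let $P^a=\operatorname{Reg}(\mathcal T_{XY}^a)$, a semigroup under $\star_a$. (i) If $|P^a|\geq\aleph_0$, then $\operatorname{rank}(P^a)=|P^a|$. (ii) If $|P^a|<\aleph_0$ (so that [$\alpha=1$ and $|Y|<\aleph_0$] or [$\alpha\geq2$, $|X|<\aleph_0$ and $\lambda_i<\aleph_0$ for all $i\in I$]), then $$\operatorname{rank}(P^a)=\begin{cases}|Y|&\text{if }\alpha=1\\ 1+\max(\alpha^\beta,\Lambda_I)&\text{if }\alpha\geq2.\end{cases}$$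
   Context: Maps are written on the right and composed left to right. $\mathcal T_{XY}$ is the set of all (totally defined) functions $X\to Y$; $\mathcal T_{XY}^a$ is the sandwich semigroup $(\mathcal T_{XY},\star_a)$ with $f\star_ag=fag$; $\operatorname{Reg}(\mathcal T_{XY}^a)$ is the set of its regular elements, i.e. those $f$ with $f=f\star_ag\star_af$ for some $g\in\mathcal T_{XY}$; it is a subsemigroup. For a function, $\operatorname{rank}(a)=|\operatorname{im}(a)|$; for a semigroup $T$, $\operatorname{rank}(T)$ is the least cardinality of a generating set (as a semigroup). *)

theory Defs
  imports Main
begin

unbundle cardinal_syntax

inductive_set sg_generated :: "('a \<Rightarrow> 'a \<Rightarrow> 'a) \<Rightarrow> 'a set \<Rightarrow> 'a set"
  for mul :: "'a \<Rightarrow> 'a \<Rightarrow> 'a" and G :: "'a set" where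
  gen: "x \<in> G \<Longrightarrow> x \<in> sg_generated mul G"
| mul: "x \<in> sg_generated mul G \<Longrightarrow> y \<in> sg_generated mul G \<Longrightarrow> mul x y \<in> sg_generated mul G"

definition sg_generates :: "('a \<Rightarrow> 'a \<Rightarrow> 'a) \<Rightarrow> 'a set \<Rightarrow> 'a set \<Rightarrow> bool" where
  "sg_generates mul S G \<longleftrightarrow> G \<subseteq> S \<and> sg_generated mul G = S"

(* The least cardinality of a generating set, as a (possibly infinite) cardinal: a Card_order
   on 'a, to be compared with other cardinals up to =o.  See sg_rank_least below. *)
definition sg_rank :: "('a \<Rightarrow> 'a \<Rightarrow> 'a) \<Rightarrow> 'a set \<Rightarrow> 'a rel" where
  "sg_rank mul S =
     |SOME G. sg_generates mul S G \<and> (\<forall>H. sg_generates mul S H \<longrightarrow> |G| \<le>o |H| )|"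

lemma sg_rank_least:
  assumes "\<And>x y. x \<in> S \<Longrightarrow> y \<in> S \<Longrightarrow> mul x y \<in> S"
  shows "\<exists>G. sg_generates mul S G \<and> sg_rank mul S = |G|"
    and "sg_generates mul S H \<Longrightarrow> sg_rank mul S \<le>o |H|"
proof -
  have "sg_generated mul S \<subseteq> S"
  proof
    fix x assume "x \<in> sg_generated mul S"
    then show "x \<in> S" by induction (auto intro: assms)
  qed
  then have "sg_generates mul S S"
    by (auto simp: sg_generates_def intro: sg_generated.gen)
  then have "card_of ` {G. sg_generates mul S G} \<noteq> {}" by blast
  then obtain G where "sg_generates mul S G" "\<forall>H. sg_generates mul S H \<longrightarrow> |G| \<le>o |H|"
    using exists_minim_Card_order[of "card_of ` {G. sg_generates mul S G}"]
    by (auto simp: card_of_Card_order)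
  then have "\<exists>G. sg_generates mul S G \<and> (\<forall>H. sg_generates mul S H \<longrightarrow> |G| \<le>o |H| )" by blast
  from someI_ex[OF this]
  show "\<exists>G. sg_generates mul S G \<and> sg_rank mul S = |G|"
    and "sg_generates mul S H \<Longrightarrow> sg_rank mul S \<le>o |H|"
    unfolding sg_rank_def by blast+
qed

(* X and Y are rendered as types, so that 'x \<Rightarrow> 'y is the set of all maps from X to Y.
   Maps act on the right: the product f a g sends x to ((x f) a) g. *)
definition sandwich :: "('y \<Rightarrow> 'x) \<Rightarrow> ('x \<Rightarrow> 'y) \<Rightarrow> ('x \<Rightarrow> 'y) \<Rightarrow> 'x \<Rightarrow> 'y" where
  "sandwich a f g = g \<circ> a \<circ> f"

definition Reg :: "('y \<Rightarrow> 'x) \<Rightarrow> ('x \<Rightarrow> 'y) set" where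
  "Reg a = {f. \<exists>g. f = sandwich a (sandwich a f g) f}"

lemma sandwich_assoc: "sandwich a (sandwich a f g) h = sandwich a f (sandwich a g h)"
  by (simp add: sandwich_def comp_assoc)

lemma Reg_iff: "f \<in> Reg a \<longleftrightarrow> inj_on a (range f) \<and> range (f \<circ> a) = range f"
proof
  assume "f \<in> Reg a"
  then obtain g where g: "\<And>x. f x = f (a (g (a (f x))))"
    by (auto simp: Reg_def sandwich_def fun_eq_iff)
  have "inj_on a (range f)"
    by (rule inj_onI) (metis g rangeE)
  moreover have "range (f \<circ> a) = range f"
    using g by (auto simp: image_iff)
  ultimately show "inj_on a (range f) \<and> range (f \<circ> a) = range f" ..
next
  assume *: "inj_on a (range f) \<and> range (f \<circ> a) = range f"
  then have ex: "\<exists>y. a (f (a y)) = a (f x)" for x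
    by (metis comp_apply rangeE rangeI)
  define g where "g z = (SOME y. a (f (a y)) = z)" for z
  have "a (f (a (g (a (f x))))) = a (f x)" for x
    unfolding g_def by (rule someI_ex[OF ex])
  then have "f (a (g (a (f x)))) = f x" for x
    using * by (meson inj_on_def rangeI)
  then show "f \<in> Reg a"
    by (auto simp: Reg_def sandwich_def fun_eq_iff intro!: exI[of _ g])
qed

lemma sandwich_in_Reg:
  assumes "f \<in> Reg a" "g \<in> Reg a"
  shows "sandwich a f g \<in> Reg a"
proof -
  have "inj_on a (range (sandwich a f g))"
    using assms(2) by (auto simp: Reg_iff sandwich_def intro: inj_on_subset)
  moreover have "range (sandwich a f g \<circ> a) = (g \<circ> a) ` range (f \<circ> a)"
    by (auto simp: sandwich_def)
  moreover have "range (sandwich a f g) = (g \<circ> a) ` range f"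
    by (auto simp: sandwich_def)
  ultimately show ?thesis
    using assms(1) by (simp add: Reg_iff)
qed

end

theory Submission
  imports Defs "HOL-Library.FuncSet" "HOL-Combinatorics.Permutations"
begin

text \<open>
  If \<open>\<alpha>\<close> is finite, number the points of \<open>im a\<close> as \<open>p 0, \<dots>, p (\<alpha> - 1)\<close>. The regular elements are
  then exactly the maps \<open>t \<circ> h \<circ> r\<close>, where \<open>r\<close> is a retraction of \<open>X\<close> onto the index set (\<open>\<alpha>\<^sup>\<beta>\<close>
  choices), \<open>h\<close> a transformation of the index set and \<open>t\<close> a section of \<open>a\<close> (\<open>\<Lambda>\<^sub>I\<close> choices); the product
  of \<open>t \<circ> h \<circ> r\<close> and \<open>t' \<circ> h' \<circ> r'\<close> is \<open>t' \<circ> h' \<circ> h \<circ> r\<close>, as in the direct product of a rectangular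
  band with the full transformation semigroup.

  The image of a product lies in the image of its last factor, and its kernel contains the kernel
  of its first factor. Hence every transversal and every retraction kernel is realised by a
  generator that is injective on \<open>im a\<close>, and one more generator is needed because these elements
  are closed under products. Conversely, \<open>max(\<alpha>\<^sup>\<beta>, \<Lambda>\<^sub>I) \<ge> 2\<close> since \<open>a\<close> is not bijective, so that many
  triples can exhaust all \<open>r\<close> and \<open>t\<close> while also carrying a full cycle and a transposition; powers
  isolate the band components, and one element of rank \<open>\<alpha> - 1\<close> supplies the singular
  transformations.

  If the semigroup is infinite, an infinite generating set must have full cardinality. A finite one
  would make the semigroup countable, which forces \<open>im a\<close> to be finite; then \<open>Y\<close> is the union of the
  images of the generators and, for \<open>\<alpha> \<ge> 2\<close>, the generators separate the points of \<open>X\<close>, so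
  everything is finite.
\<close>

section \<open>Generating the full transformation semigroup\<close>

text \<open>Conjugating the transposition by powers of the cycle gives the adjacent transpositions,
  hence all permutations; conjugating the collapse by permutations gives every
  \<open>id(i := j)\<close>. The remaining maps follow by induction on the number of points missed
  by the image. Only values below \<open>n\<close> carry meaning, hence the closure
  \<open>cong\<close> under agreement there.\<close>

lemma transformations_generated:
  fixes Q :: "(nat \<Rightarrow> nat) set" and n :: nat
  assumes n: "n \<ge> 2"
    and comp: "\<And>g h. g \<in> Q \<Longrightarrow> h \<in> Q \<Longrightarrow> g \<circ> h \<in> Q"
    and cong: "\<And>g h. g \<in> Q \<Longrightarrow> (\<And>k. k < n \<Longrightarrow> g k = h k) \<Longrightarrow> h \<in> Q"
    and "id \<in> Q"
    and cycle: "(\<lambda>k. Suc k mod n) \<in> Q"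
    and swap: "transpose 0 1 \<in> Q"
    and collapse: "id(1 := 0) \<in> Q"
    and h: "h ` {..<n} \<subseteq> {..<n}"
  shows "h \<in> Q"
proof -
  have rotate: "(\<lambda>k. (k + j) mod n) \<in> Q" for j
  proof (induction j)
    case 0
    show ?case by (rule cong[OF \<open>id \<in> Q\<close>]) simp
  next
    case (Suc j)
    show ?case by (rule cong[OF comp[OF cycle Suc]]) (simp add: mod_Suc_eq)
  qed
  \<comment> \<open>Conjugation by the rotation through \<open>i\<close>; its inverse is the
    rotation through \<open>n - i\<close>.\<close>
  have adjacent: "transpose i (Suc i) \<in> Q" if "Suc i < n" for i
  proof (rule cong[OF comp[OF rotate[of i] comp[OF swap rotate[of "n - i"]]]])
    fix k assume "k < n"
    consider "k < i" | "k = i" | "k = Suc i" | "k > Suc i" by linarith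
    then show "((\<lambda>k. (k + i) mod n) \<circ> (transpose 0 1 \<circ> (\<lambda>k. (k + (n - i)) mod n))) k
        = transpose i (Suc i) k"
    proof cases
      case 1
      then have "k + (n - i) \<noteq> 1" "k + (n - i) < n" using that by auto
      then show ?thesis using 1 that by (simp add: transpose_def)
    next
      case 4
      then have "(k + (n - i)) mod n = k - i"
        using that \<open>k < n\<close> by (simp add: mod_if)
      then show ?thesis using 4 \<open>k < n\<close> by (simp add: transpose_def)
    qed (use that in \<open>simp_all add: transpose_def mod_if\<close>)
  qed
  have ordered: "transpose i (i + Suc d) \<in> Q" if "i + Suc d < n" for i d
    using that
  proof (induction d)
    case 0
    then show ?case using adjacent by simp
  next
    case (Suc d)
    \<comment> \<open>Conjugating by an adjacent transposition moves the upper end one place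
      further.\<close>
    let ?s = "transpose (i + Suc d) (Suc (i + Suc d))"
    have "?s \<circ> (transpose i (i + Suc d) \<circ> ?s) \<in> Q"
      using Suc adjacent[of "i + Suc d"] by (intro comp) auto
    moreover have "?s \<circ> (transpose i (i + Suc d) \<circ> ?s) = transpose i (i + Suc (Suc d))"
      by (auto simp: fun_eq_iff transpose_def)
    ultimately show ?case by simp
  qed
  have transp: "transpose i j \<in> Q" if "i < n" "j < n" "i \<noteq> j" for i j
  proof (cases "i < j")
    case True
    then show ?thesis using ordered[of i "j - i - 1"] that by simp
  next
    case False
    then show ?thesis using ordered[of j "i - j - 1"] that by (simp add: transpose_commute)
  qed
  have perm: "q \<in> Q" if "q permutes {..<n}" for q
    using that finite_lessThan
  proof (induction rule: permutes_induct)
    case id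
    show ?case by fact
  next
    case (swap i j q)
    then show ?case by (intro comp transp) auto
  qed
  have collapse': "id(i := j) \<in> Q" if "i < n" "j < n" "i \<noteq> j" for i j
  proof -
    \<comment> \<open>A permutation with \<open>q 0 = j\<close> and \<open>q 1 = i\<close>, so
      conjugation by it turns \<open>id(1 := 0)\<close> into \<open>id(i := j)\<close>.\<close>
    define q where "q = transpose 0 j \<circ> transpose 1 (transpose 0 j i)"
    have q: "q permutes {..<n}"
      unfolding q_def using that n
      by (intro permutes_compose permutes_swap_id) (auto simp: transpose_def)
    have "q 0 = j" "q 1 = i"
      using that by (auto simp: q_def transpose_def)
    moreover have "inv q i = 1"
      using \<open>q 1 = i\<close> permutes_inverses(2)[OF q] by metis
    moreover have "inv q k \<noteq> 1" if "k \<noteq> i" for k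
      using that \<open>q 1 = i\<close> permutes_inverses(1)[OF q] by metis
    ultimately have "q \<circ> (id(1 := 0) \<circ> inv q) = id(i := j)"
      using permutes_inverses(1)[OF q] by (auto simp: fun_eq_iff)
    moreover have "q \<circ> (id(1 := 0) \<circ> inv q) \<in> Q"
      using q by (intro comp collapse perm permutes_inv)
    ultimately show ?thesis by simp
  qed
  show ?thesis using h
  proof (induction "n - card (h ` {..<n})" arbitrary: h rule: less_induct)
    case less
    show ?case
    proof (cases "inj_on h {..<n}")
      case True
      then have "bij_betw h {..<n} {..<n}"
        using less.prems by (simp add: bij_betw_def endo_inj_surj)
      then have "(\<lambda>k. if k \<in> {..<n} then h k else k) permutes {..<n}"
        by (intro bij_imp_permutes) (auto simp: bij_betw_def inj_on_def image_iff)
      from perm[OF this] show ?thesis by (rule cong) simp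
    next
      case False
      then obtain i j where ij: "i < n" "j < n" "i \<noteq> j" "h i = h j"
        by (auto simp: inj_on_def)
      have "card (h ` {..<n}) < n"
        using False card_image_le[of "{..<n}" h] eq_card_imp_inj_on[of "{..<n}" h]
        by fastforce
      then have "h ` {..<n} \<noteq> {..<n}" by auto
      \<comment> \<open>Sending \<open>i\<close> to a missed point \<open>k\<close> enlarges the
        image, because \<open>j\<close> still attains the old value \<open>h i\<close>; composing
        with \<open>id(i := j)\<close> recovers \<open>h\<close>.\<close>
      then obtain k where k: "k < n" "k \<notin> h ` {..<n}"
        using less.prems by auto
      have im: "h(i := k) ` {..<n} = insert k (h ` {..<n})"
        using ij by (auto simp: image_iff)
      then have "h(i := k) \<in> Q"
        using k \<open>card (h ` {..<n}) < n\<close> less.prems by (intro less.hyps) (simp_all add: im)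
      moreover have "h = h(i := k) \<circ> id(i := j)"
        using ij by auto
      ultimately show ?thesis
        using comp collapse' ij by metis
    qed
  qed
qed

section \<open>Cardinality of generated semigroups\<close>

text \<open>The products of bracketing depth at most \<open>n\<close>; they exhibit the generated
  semigroup as a countable union whose stages are easy to bound.\<close>

primrec products :: "('a \<Rightarrow> 'a \<Rightarrow> 'a) \<Rightarrow> 'a set \<Rightarrow> nat \<Rightarrow> 'a set" where
  "products mul G 0 = G"
| "products mul G (Suc n)
    = products mul G n \<union> (\<lambda>(x, y). mul x y) ` (products mul G n \<times> products mul G n)"

lemma products_mono: "m \<le> n \<Longrightarrow> products mul G m \<subseteq> products mul G n"
  by (rule lift_Suc_mono_le) auto

lemma sg_generated_subset_products: "sg_generated mul G \<subseteq> (\<Union>n. products mul G n)"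
proof
  fix x assume "x \<in> sg_generated mul G"
  then show "x \<in> (\<Union>n. products mul G n)"
  proof induction
    case (gen x)
    then show ?case by (auto intro: exI[of _ 0])
  next
    case (mul x y)
    then obtain m n where "x \<in> products mul G m" "y \<in> products mul G n" by auto
    then have "x \<in> products mul G (max m n)" "y \<in> products mul G (max m n)"
      using products_mono[of m "max m n" mul G] products_mono[of n "max m n" mul G] by auto
    then have "mul x y \<in> products mul G (Suc (max m n))" by force
    then show ?case by blast
  qed
qed

text \<open>Each stage and the number of stages are bounded by the infinite cardinal of
  \<open>L\<close>. Keeping \<open>L\<close> apart from \<open>G\<close> also covers a finite
  \<open>G\<close>, with the natural numbers as \<open>L\<close>.\<close>

lemma card_of_sg_generated:
  assumes L: "infinite L" and G: "|G| \<le>o |L|"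
  shows "|sg_generated mul G| \<le>o |L|"
proof -
  have "|products mul G n| \<le>o |L|" for n
  proof (induction n)
    case (Suc n)
    have "|products mul G n \<times> products mul G n| \<le>o |L|"
      using card_of_Times_ordLeq_infinite_Field[of "|L|", OF _ Suc Suc card_of_Card_order] L
      by (simp add: Field_card_of)
    then have "|(\<lambda>(x, y). mul x y) ` (products mul G n \<times> products mul G n)| \<le>o |L|"
      using card_of_image ordLeq_transitive by blast
    then show ?case
      using card_of_Un_ordLeq_infinite_Field[of "|L|", OF _ Suc _ card_of_Card_order] L
      by (simp add: Field_card_of)
  qed (simp add: G)
  moreover have "|UNIV :: nat set| \<le>o |L|"
    using L by (simp add: infinite_iff_card_of_nat)
  ultimately have "|\<Union>n. products mul G n| \<le>o |L|"
    using card_of_UNION_ordLeq_infinite[OF L] by blast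
  then show ?thesis
    using card_of_mono1[OF sg_generated_subset_products] ordLeq_transitive by blast
qed

text \<open>Passes from the cardinal-valued rank to natural numbers: a bound below all generating
  sets, together with one generating set that meets it, determines the rank.\<close>

lemma sg_rank_finite:
  assumes "\<And>x y. x \<in> S \<Longrightarrow> y \<in> S \<Longrightarrow> mul x y \<in> S"
    and "finite S"
    and lower: "\<And>H. sg_generates mul S H \<Longrightarrow> N \<le> card H"
    and H: "sg_generates mul S H" "card H \<le> N"
  shows "sg_rank mul S =o |{..<N}|"
proof -
  obtain G where G: "sg_generates mul S G" "sg_rank mul S = |G|"
    using sg_rank_least(1)[of S mul] assms(1) by blast
  have "|G| \<le>o |H|"
    using sg_rank_least(2)[of S mul, OF assms(1) H(1)] G(2) by simp
  moreover have "finite G" "finite H"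
    using G(1) H(1) \<open>finite S\<close> by (auto simp: sg_generates_def intro: finite_subset)
  ultimately have "card G \<le> N"
    using H(2) card_inj_on_le by (metis card_of_ordLeq order_trans)
  then have "card G = card {..<N}"
    using lower[OF G(1)] by simp
  then show ?thesis
    using G(2) \<open>finite G\<close> finite_lessThan
    by (metis card_of_ordIso finite_same_card_bij)
qed

section \<open>Images and kernels of generators\<close>

lemma Reg_inj: "f \<in> Reg a \<Longrightarrow> a (f x) = a (f y) \<Longrightarrow> f x = f y"
  by (auto simp: Reg_iff dest: inj_onD)

lemma Reg_value_on_range: "f \<in> Reg a \<Longrightarrow> \<exists>y. f (a y) = f x"
  unfolding Reg_iff by (metis comp_apply rangeE rangeI)

lemma const_in_Reg: "(\<lambda>_. y) \<in> Reg a"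
  by (auto simp: Reg_iff)

lemma two_valued_in_Reg:
  assumes "a y \<noteq> a y'" "s \<in> S \<inter> range a" "s' \<in> range a - S"
  shows "(\<lambda>x. if x \<in> S then y else y') \<in> Reg a"
proof -
  have "inj_on a (range (\<lambda>x. if x \<in> S then y else y'))"
    using assms(1) by (auto simp: inj_on_def)
  moreover have "y \<in> range ((\<lambda>x. if x \<in> S then y else y') \<circ> a)"
    "y' \<in> range ((\<lambda>x. if x \<in> S then y else y') \<circ> a)"
    using assms(2,3) by (auto simp: image_iff)
  then have "range ((\<lambda>x. if x \<in> S then y else y') \<circ> a) = range (\<lambda>x. if x \<in> S then y else y')"
    by auto
  ultimately show ?thesis by (simp add: Reg_iff)
qed

lemma sg_generated_range:
  "f \<in> sg_generated (sandwich a) G \<Longrightarrow> \<exists>g\<in>G. range f \<subseteq> range g"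
proof (induction rule: sg_generated.induct)
  case (mul f g)
  have "range (sandwich a f g) \<subseteq> range g"
    by (auto simp: sandwich_def)
  then show ?case using mul.IH(2) by blast
qed auto

lemma sg_generated_kernel:
  "f \<in> sg_generated (sandwich a) G \<Longrightarrow> \<exists>g\<in>G. \<forall>x x'. g x = g x' \<longrightarrow> f x = f x'"
proof (induction rule: sg_generated.induct)
  case (mul f g)
  then show ?case unfolding sandwich_def comp_apply by metis
qed auto

section \<open>Generators forced by ranges, kernels and non-injectivity\<close>

text \<open>Some generator \<open>g\<close> has at least the range of \<open>f\<close>. It has no
  more, since \<open>a\<close> is injective on \<open>range g\<close> and already maps
  \<open>range f\<close> onto \<open>range a\<close>.\<close>

lemma generator_same_range:
  assumes G: "sg_generates (sandwich a) (Reg a) G"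
    and f: "f \<in> Reg a" "range a \<subseteq> range (a \<circ> f)"
  shows "\<exists>g\<in>G. range g = range f"
proof -
  obtain g where g: "g \<in> G" "range f \<subseteq> range g"
    using sg_generated_range[of f a G] G f(1) by (auto simp: sg_generates_def)
  have "g \<in> Reg a" using G g(1) by (auto simp: sg_generates_def)
  have "g x \<in> range f" for x
  proof -
    obtain x' where "a (g x) = a (f x')" using f(2) by force
    moreover obtain x'' where "f x' = g x''" using g(2) by blast
    ultimately have "g x = f x'" using Reg_inj[OF \<open>g \<in> Reg a\<close>] by metis
    then show ?thesis by blast
  qed
  then show ?thesis using g by blast
qed

text \<open>Some generator \<open>g\<close> has its kernel inside that of \<open>f\<close>. The
  kernels agree because every value of \<open>g\<close> is attained on \<open>range a\<close>, where
  \<open>f\<close> is injective.\<close>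

lemma generator_same_kernel:
  assumes G: "sg_generates (sandwich a) (Reg a) G"
    and f: "f \<in> Reg a" "inj_on f (range a)"
  shows "\<exists>g\<in>G. \<forall>x x'. g x = g x' \<longleftrightarrow> f x = f x'"
proof -
  obtain g where g: "g \<in> G" and ker: "\<And>x x'. g x = g x' \<Longrightarrow> f x = f x'"
    using sg_generated_kernel[of f a G] G f(1) by (auto simp: sg_generates_def)
  have "g \<in> Reg a" using G g by (auto simp: sg_generates_def)
  have "g x = g x'" if "f x = f x'" for x x'
  proof -
    obtain y y' where y: "g (a y) = g x" "g (a y') = g x'"
      using Reg_value_on_range[OF \<open>g \<in> Reg a\<close>] by metis
    then have "f (a y) = f (a y')" using ker that by metis
    then show ?thesis using y f(2) by (metis inj_onD rangeI)
  qed
  then show ?thesis using g ker by blast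
qed

text \<open>Regular elements injective on \<open>range a\<close> are closed under the product,
  whereas a constant map is regular and not injective there.\<close>

lemma noninjective_generator:
  assumes G: "sg_generates (sandwich a) (Reg a) G" and "a u \<noteq> a v"
  shows "\<exists>g\<in>G. \<not> inj_on g (range a)"
proof (rule ccontr)
  assume "\<not> ?thesis"
  then have inj: "\<And>g. g \<in> G \<Longrightarrow> inj_on g (range a)" by blast
  have "f \<in> Reg a \<and> inj_on f (range a)" if "f \<in> sg_generated (sandwich a) G" for f
    using that
  proof induction
    case (gen f)
    then show ?case using G inj by (auto simp: sg_generates_def)
  next
    case (mul f g)
    have "inj_on (sandwich a f g) (range a)"
      using mul.IH Reg_inj[of f a] unfolding sandwich_def inj_on_def
      by (metis comp_apply rangeI)
    then show ?case using mul.IH by (simp add: sandwich_in_Reg)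
  qed
  then have "inj_on (\<lambda>_. undefined :: 'b) (range a)"
    using G const_in_Reg[of undefined a] by (auto simp: sg_generates_def)
  then show False using \<open>a u \<noteq> a v\<close> by (auto simp: inj_on_def)
qed

section \<open>Finiteness forced by a finite generating set\<close>

text \<open>All constant maps must be generated, so the ranges of the generators cover the codomain;
  \<open>a\<close> embeds each of these ranges into the finite set \<open>range a\<close>.\<close>

lemma finite_codomain_if_finite_generators:
  fixes a :: "'y \<Rightarrow> 'x"
  assumes G: "sg_generates (sandwich a) (Reg a) G" "finite G" and "finite (range a)"
  shows "finite (UNIV :: 'y set)"
proof -
  have "\<exists>g\<in>G. y \<in> range g" for y
    using sg_generated_range[of "\<lambda>_. y" a G] G const_in_Reg[of y a]
    by (auto simp: sg_generates_def)
  then have "UNIV = (\<Union>g\<in>G. range g)" by auto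
  moreover have "finite (range g)" if "g \<in> G" for g
  proof (rule finite_imageD)
    show "finite (a ` range g)" using assms(3) by (rule finite_subset[rotated]) auto
    show "inj_on a (range g)" using that G by (auto simp: sg_generates_def Reg_iff)
  qed
  ultimately show ?thesis using finite_UN_I[of G range] G(2) by simp
qed

lemma Reg_separates_points:
  assumes "a u \<noteq> a v" "x \<noteq> x'"
  shows "\<exists>f\<in>Reg a. f x \<noteq> f x'"
proof -
  \<comment> \<open>The set \<open>S\<close> has to split both the pair \<open>x\<close>,
    \<open>x'\<close> and \<open>range a\<close>, so that the two-valued map it defines is
    regular.\<close>
  have "\<exists>S s s'. x \<in> S \<and> x' \<notin> S \<and> s \<in> S \<inter> range a \<and> s' \<in> range a - S"
  proof (cases "x \<in> range a")
    case True
    moreover obtain w where "a w \<noteq> x" using assms(1) by metis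
    ultimately show ?thesis using assms(2) by (intro exI[of _ "{x}"]) auto
  next
    case False
    show ?thesis
    proof (cases "x' \<in> range a")
      case True
      moreover obtain w where "a w \<noteq> x'" using assms(1) by metis
      ultimately show ?thesis using assms(2) by (intro exI[of _ "- {x'}"]) auto
    next
      case False': False
      have "a v \<notin> {x, a u}" "x' \<notin> {x, a u}" using assms False False' by auto
      then show ?thesis by (intro exI[of _ "{x, a u}"]) blast
    qed
  qed
  then obtain S s s' where S: "x \<in> S" "x' \<notin> S" "s \<in> S \<inter> range a" "s' \<in> range a - S" by blast
  then have "(\<lambda>x. if x \<in> S then u else v) \<in> Reg a" "u \<noteq> v"
    using two_valued_in_Reg[of a u v, OF assms(1)] assms(1) by auto
  then show ?thesis using S by (intro bexI[of _ "\<lambda>x. if x \<in> S then u else v"]) auto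
qed

text \<open>Regular maps separate points, hence so do the generators, and a point is determined by
  the finite tuple of its values under them.\<close>

lemma finite_domain_if_finite_generators:
  fixes a :: "'y \<Rightarrow> 'x"
  assumes G: "sg_generates (sandwich a) (Reg a) G" "finite G" and "finite (range a)"
    and uv: "a u \<noteq> a v"
  shows "finite (UNIV :: 'x set)"
proof (rule finite_imageD)
  let ?e = "\<lambda>x. \<lambda>g\<in>G. g x"
  have "finite (\<Pi>\<^sub>E g\<in>G. UNIV :: 'y set)"
    using finite_codomain_if_finite_generators[OF G assms(3)] G(2) by (intro finite_PiE) auto
  then show "finite (range ?e)"
    by (rule finite_subset[rotated]) auto
  show "inj ?e"
  proof (rule injI, rule ccontr)
    fix x x' assume eq: "?e x = ?e x'" and "x \<noteq> x'"
    then obtain f where f: "f \<in> Reg a" "f x \<noteq> f x'"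
      using Reg_separates_points[of a, OF uv] by blast
    then obtain g where "g \<in> G" "g x \<noteq> g x'"
      using sg_generated_kernel[of f a G] G(1) by (auto simp: sg_generates_def)
    then show False using fun_cong[OF eq, of g] by simp
  qed
qed

lemma Reg_const:
  assumes "\<And>u v. a u = a v"
  shows "Reg a = range (\<lambda>y _. y)"
proof
  show "Reg a \<subseteq> range (\<lambda>y _. y)"
  proof
    fix f assume "f \<in> Reg a"
    then have "f x = f (a undefined)" for x
      using Reg_inj assms by metis
    then show "f \<in> range (\<lambda>y _. y)" by (auto simp: image_iff fun_eq_iff)
  qed
qed (auto intro: const_in_Reg)

text \<open>The power set of \<open>range a\<close> embeds into the regular elements through
  two-valued maps.\<close>

lemma infinite_rank_uncountable:
  fixes a :: "'y \<Rightarrow> 'x"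
  assumes "infinite (range a)"
  shows "|UNIV :: nat set| <o |Reg a|"
proof -
  obtain u v where uv: "a u \<noteq> a v"
  proof -
    have "\<not> range a \<subseteq> {a undefined}"
      using assms finite_subset by blast
    then show ?thesis using that by auto
  qed
  \<comment> \<open>Points outside \<open>range a\<close> are treated like \<open>a u\<close>, so
    every value is attained on \<open>range a\<close>, even when \<open>F S\<close> is
    constant.\<close>
  define F where "F S x = (if (if x \<in> range a then x else a u) \<in> S then u else v)" for S x
  have "F S \<in> Reg a" for S
  proof -
    have "inj_on a (range (F S))"
      using uv by (auto simp: F_def inj_on_def)
    moreover have "F S x \<in> range (F S \<circ> a)" for x
    proof -
      have "F S x = (F S \<circ> a) (if x \<in> range a then inv a x else u)"
        by (auto simp: F_def f_inv_into_f)
      then show ?thesis by (metis rangeI)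
    qed
    then have "range (F S \<circ> a) = range (F S)" by auto
    ultimately show ?thesis by (simp add: Reg_iff)
  qed
  moreover have "inj_on F (Pow (range a))"
  proof (rule inj_onI)
    fix S T assume ST: "S \<in> Pow (range a)" "T \<in> Pow (range a)" "F S = F T"
    have "x \<in> S \<longleftrightarrow> x \<in> T" if "x \<in> range a" for x
      using fun_cong[OF ST(3), of x] that uv by (auto simp: F_def split: if_splits)
    then show "S = T" using ST by blast
  qed
  ultimately have "|Pow (range a)| \<le>o |Reg a|"
    by (auto simp flip: card_of_ordLeq)
  moreover have "|UNIV :: nat set| \<le>o |range a|"
    using assms by (simp add: infinite_iff_card_of_nat)
  ultimately show ?thesis
    using card_of_Pow ordLeq_ordLess_trans ordLess_ordLeq_trans by blast
qed

lemma finite_Reg_if_finite_generators: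
  fixes a :: "'y \<Rightarrow> 'x"
  assumes G: "sg_generates (sandwich a) (Reg a) G" "finite G"
  shows "finite (Reg a)"
proof -
  have "|G| \<le>o |UNIV :: nat set|"
    using G(2) finite_iff_ordLess_natLeq ordLess_imp_ordLeq
    by (metis card_of_nat ordIso_symmetric ordLeq_ordIso_trans)
  then have "|Reg a| \<le>o |UNIV :: nat set|"
    using card_of_sg_generated[of "UNIV :: nat set" G "sandwich a"] G(1)
    by (simp add: sg_generates_def)
  then have fin: "finite (range a)"
    using infinite_rank_uncountable not_ordLess_ordLeq by blast
  have Y: "finite (UNIV :: 'y set)"
    by (rule finite_codomain_if_finite_generators[OF G fin])
  show ?thesis
  \<comment> \<open>For constant \<open>a\<close> all regular maps are constant and separate no
    points of the domain, so that case is counted directly.\<close>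
  proof (cases "\<exists>u v. a u \<noteq> a v")
    case True
    then have "finite (UNIV :: 'x set)"
      using finite_domain_if_finite_generators[OF G fin] by blast
    then have "finite (\<Pi>\<^sub>E x\<in>(UNIV :: 'x set). UNIV :: 'y set)"
      using Y by (intro finite_PiE)
    then show ?thesis by (rule finite_subset[rotated]) auto
  next
    case False
    then have "Reg a = range (\<lambda>y _. y)" by (intro Reg_const) auto
    then show ?thesis using Y by simp
  qed
qed

section \<open>The rank when the semigroup is infinite or \<open>a\<close> is constant\<close>

lemma sg_rank_Reg_infinite:
  assumes "infinite (Reg a)"
  shows "sg_rank (sandwich a) (Reg a) =o |Reg a|"
proof -
  obtain G where G: "sg_generates (sandwich a) (Reg a) G" "sg_rank (sandwich a) (Reg a) = |G|"
    using sg_rank_least(1)[of "Reg a" "sandwich a"] sandwich_in_Reg by blast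
  have "infinite G" using finite_Reg_if_finite_generators[OF G(1)] assms by blast
  then have "|Reg a| \<le>o |G|"
    using card_of_sg_generated[of G G "sandwich a"] G(1)
    by (simp add: sg_generates_def ordLeq_refl card_of_Card_order)
  moreover have "|G| \<le>o |Reg a|"
    using G(1) by (simp add: sg_generates_def card_of_mono1)
  ultimately show ?thesis using G(2) by (simp add: ordIso_iff_ordLeq)
qed

text \<open>The regular elements are the constant maps, and a product of constants equals its last
  factor. Nothing new is ever generated, so the only generating set is the whole semigroup.\<close>

lemma sg_rank_Reg_const:
  fixes a :: "'y \<Rightarrow> 'x"
  assumes "\<And>u v. a u = a v"
  shows "sg_rank (sandwich a) (Reg a) =o |UNIV :: 'y set|"
proof -
  obtain G where G: "sg_generates (sandwich a) (Reg a) G" "sg_rank (sandwich a) (Reg a) = |G|"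
    using sg_rank_least(1)[of "Reg a" "sandwich a"] sandwich_in_Reg by blast
  have "f \<in> G" if "f \<in> sg_generated (sandwich a) G" for f
    using that
  proof induction
    case (mul f g)
    then obtain y where "g = (\<lambda>_. y)"
      using G(1) Reg_const[of a, OF assms] by (auto simp: sg_generates_def)
    then show ?case using mul.IH by (simp add: sandwich_def comp_def)
  qed
  then have "G = Reg a"
    using G(1) by (auto simp: sg_generates_def)
  moreover have "bij_betw (\<lambda>y (_ :: 'x). y) (UNIV :: 'y set) (Reg a)"
    using Reg_const[of a, OF assms] by (auto simp: bij_betw_def inj_on_def fun_eq_iff)
  then have "|Reg a| =o |UNIV :: 'y set|"
    using card_of_ordIso ordIso_symmetric by blast
  ultimately show ?thesis using G(2) by simp
qed

section \<open>The case of finite rank\<close>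

text \<open>Enumeration with repetitions: it lets retractions and sections be listed over one common
  index set although their numbers may differ.\<close>

lemma ex_surj_lessThan:
  assumes "finite B" "B \<noteq> {}" "card B \<le> M"
  shows "\<exists>f. f ` {..<M :: nat} = B"
proof -
  have "card B \<le> card {..<M}" using assms(3) by simp
  then obtain f where "f ` B \<subseteq> {..<M}" "inj_on f B"
    using card_le_inj[OF assms(1) finite_lessThan] by blast
  then have "B = inv_into B f ` f ` B" by simp
  obtain b where b: "b \<in> B" using assms(2) by blast
  have "(\<lambda>k. if k \<in> f ` B then inv_into B f k else b) ` {..<M} = B"
  proof
    show "(\<lambda>k. if k \<in> f ` B then inv_into B f k else b) ` {..<M} \<subseteq> B"
      using b by (auto intro: inv_into_into)
    show "B \<subseteq> (\<lambda>k. if k \<in> f ` B then inv_into B f k else b) ` {..<M}"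
    proof
      fix x assume "x \<in> B"
      then show "x \<in> (\<lambda>k. if k \<in> f ` B then inv_into B f k else b) ` {..<M}"
        using \<open>f ` B \<subseteq> {..<M}\<close> \<open>inj_on f B\<close> by (intro image_eqI[of _ _ "f x"]) auto
    qed
  qed
  then show ?thesis by blast
qed

section \<open>Coordinates for regular elements: retraction, transformation, section\<close>

locale rank_coordinates =
  fixes a :: "'y \<Rightarrow> 'x" and p :: "nat \<Rightarrow> 'x" and n :: nat
  assumes p: "bij_betw p {..<n} (range a)"
begin

definition retractions :: "('x \<Rightarrow> nat) set" where
  "retractions = {r. range r \<subseteq> {..<n} \<and> (\<forall>k<n. r (p k) = k)}"

text \<open>Extensional functions, so that sections are equal when they agree on
  \<open>{..<n}\<close> and their number is the product of the fibre sizes.\<close>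

definition sections :: "(nat \<Rightarrow> 'y) set" where
  "sections = (\<Pi>\<^sub>E k\<in>{..<n}. a -` {p k})"

lemma p_eq_iff: "j < n \<Longrightarrow> k < n \<Longrightarrow> p j = p k \<longleftrightarrow> j = k"
  using p by (auto simp: bij_betw_def inj_on_def)

lemma ex_index: "\<exists>k<n. p k = a y"
proof -
  have "a y \<in> p ` {..<n}" using p by (simp add: bij_betw_def)
  then show ?thesis by force
qed

lemma p_in_range: "k < n \<Longrightarrow> p k \<in> range a"
  using p by (auto simp: bij_betw_def)

lemma finite_range_a: "finite (range a)"
  using p bij_betw_finite by blast

lemma retraction_less: "r \<in> retractions \<Longrightarrow> r x < n"
  by (auto simp: retractions_def)

lemma retraction_p: "r \<in> retractions \<Longrightarrow> k < n \<Longrightarrow> r (p k) = k"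
  by (auto simp: retractions_def)

lemma section_p: "t \<in> sections \<Longrightarrow> k < n \<Longrightarrow> a (t k) = p k"
  by (auto simp: sections_def PiE_iff)

lemma card_sections: "card sections = (\<Prod>k<n. card (a -` {p k}))"
  by (simp add: sections_def card_PiE)

text \<open>On \<open>range a\<close> a retraction must invert \<open>p\<close>; its values
  elsewhere are free.\<close>

lemma bij_retractions:
  "bij_betw (\<lambda>r. restrict r (UNIV - range a)) retractions (\<Pi>\<^sub>E x\<in>UNIV - range a. {..<n})"
proof (rule bij_betw_byWitness[where f' = "\<lambda>g x. if x \<in> range a then inv_into {..<n} p x else g x"])
  have inv: "inv_into {..<n} p (p k) = k" if "k < n" for k
    using that p by (simp add: bij_betw_inv_into_left)
  show "\<forall>r\<in>retractions. (\<lambda>x. if x \<in> range a then inv_into {..<n} p x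
      else restrict r (UNIV - range a) x) = r"
  proof (intro ballI ext)
    fix r x assume "r \<in> retractions"
    then show "(if x \<in> range a then inv_into {..<n} p x else restrict r (UNIV - range a) x) = r x"
      using ex_index inv retraction_p by (auto; metis)
  qed
  show "\<forall>g\<in>\<Pi>\<^sub>E x\<in>UNIV - range a. {..<n}. restrict (\<lambda>x. if x \<in> range a
      then inv_into {..<n} p x else g x) (UNIV - range a) = g"
    by (auto simp: PiE_iff fun_eq_iff restrict_def extensional_def)
  show "(\<lambda>r. restrict r (UNIV - range a)) ` retractions \<subseteq> (\<Pi>\<^sub>E x\<in>UNIV - range a. {..<n})"
    by (auto simp: retraction_less)
  show "(\<lambda>g x. if x \<in> range a then inv_into {..<n} p x else g x) `
      (\<Pi>\<^sub>E x\<in>UNIV - range a. {..<n}) \<subseteq> retractions"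
  proof -
    have "inv_into {..<n} p x < n" if "x \<in> range a" for x
      using that p by (metis bij_betw_def inv_into_into lessThan_iff)
    then show ?thesis
      by (auto simp: retractions_def PiE_iff inv p_in_range)
  qed
qed

lemma card_retractions:
  assumes "finite (UNIV :: 'x set)"
  shows "card retractions = n ^ card (UNIV - range a)"
proof -
  have "finite (UNIV - range a)" using finite_subset[OF subset_UNIV assms] .
  then show ?thesis
    using bij_betw_same_card[OF bij_retractions] by (simp add: card_PiE)
qed

lemma factors_in_Reg:
  assumes "r \<in> retractions" "t \<in> sections" "h ` {..<n} \<subseteq> {..<n}"
  shows "t \<circ> h \<circ> r \<in> Reg a"
proof -
  have "h (r x) < n" for x
    using assms retraction_less by blast
  then have "inj_on a (range (t \<circ> h \<circ> r))"
    using assms(2) by (auto simp: inj_on_def section_p p_eq_iff)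
  moreover have "(t \<circ> h \<circ> r) x \<in> range (t \<circ> h \<circ> r \<circ> a)" for x
  proof -
    obtain y where "a y = p (r x)"
      using p_in_range[OF retraction_less[OF assms(1)]] by (metis rangeE)
    then have "(t \<circ> h \<circ> r) x = (t \<circ> h \<circ> r \<circ> a) y"
      using assms(1) by (simp add: retraction_less retraction_p)
    then show ?thesis by blast
  qed
  then have "range (t \<circ> h \<circ> r \<circ> a) = range (t \<circ> h \<circ> r)" by auto
  ultimately show ?thesis by (simp add: Reg_iff)
qed

lemma factors_exist:
  assumes f: "f \<in> Reg a"
  shows "\<exists>r\<in>retractions. \<exists>t\<in>sections. \<exists>h. h ` {..<n} \<subseteq> {..<n} \<and> f = t \<circ> h \<circ> r"
proof -
  \<comment> \<open>Points of \<open>range a\<close> keep their own index; any other point takes the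
    index of a point of \<open>range a\<close> with the same value under \<open>f\<close>.\<close>
  have "\<exists>k<n. f (p k) = f x \<and> (\<forall>j<n. x = p j \<longrightarrow> k = j)" for x
  proof (cases "\<exists>j<n. x = p j")
    case True
    then show ?thesis using p_eq_iff by auto
  next
    case False
    then show ?thesis using Reg_value_on_range[OF f, of x] ex_index by metis
  qed
  then obtain r where r: "\<And>x. r x < n" "\<And>x. f (p (r x)) = f x" "\<And>x j. j < n \<Longrightarrow> x = p j \<Longrightarrow> r x = j"
    by metis
  have "\<exists>j<n. p j = a (f (p k))" for k using ex_index .
  then obtain h where h: "\<And>k. h k < n" "\<And>k. p (h k) = a (f (p k))" by metis
  \<comment> \<open>The section picks the point of \<open>range f\<close> in the fibre over
    \<open>p k\<close>, unique since \<open>a\<close> is injective on \<open>range f\<close>, and an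
    arbitrary point of the fibre if \<open>range f\<close> misses it.\<close>
  have "\<exists>y. a y = p k \<and> (\<forall>x. a (f x) = p k \<longrightarrow> f x = y)" if "k < n" for k
  proof (cases "\<exists>x. a (f x) = p k")
    case True
    then show ?thesis using Reg_inj[OF f] by metis
  next
    case False
    then show ?thesis using p_in_range[OF that] by (metis rangeE)
  qed
  then obtain t where t: "\<And>k. k < n \<Longrightarrow> a (t k) = p k" "\<And>k x. k < n \<Longrightarrow> a (f x) = p k \<Longrightarrow> f x = t k"
    by metis
  have "r \<in> retractions" using r by (auto simp: retractions_def)
  moreover have "restrict t {..<n} \<in> sections" using t(1) by (auto simp: sections_def)
  moreover have "f = restrict t {..<n} \<circ> h \<circ> r"
  proof
    fix x
    have "a (f x) = p (h (r x))" using h(2) r(2) by simp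
    then show "f x = (restrict t {..<n} \<circ> h \<circ> r) x" using t(2)[OF h(1)] h(1) by simp
  qed
  moreover have "h ` {..<n} \<subseteq> {..<n}" using h(1) by auto
  ultimately show ?thesis by blast
qed

text \<open>In the middle, \<open>r' \<circ> a \<circ> t\<close> is the identity on indices.\<close>

lemma sandwich_factors:
  assumes "r' \<in> retractions" "r \<in> retractions" "t \<in> sections" "h ` {..<n} \<subseteq> {..<n}"
  shows "sandwich a (t \<circ> h \<circ> r) (t' \<circ> h' \<circ> r') = t' \<circ> (h' \<circ> h) \<circ> r"
proof -
  have "h (r x) < n" for x
    using assms retraction_less by blast
  then show ?thesis
    using assms by (auto simp: sandwich_def fun_eq_iff section_p retraction_p)
qed

section \<open>Lower bound for generating sets\<close>

text \<open>Regularity gives \<open>f\<close> the same range on \<open>range a\<close> as on the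
  whole domain, so \<open>a \<circ> f\<close> maps the finite set \<open>range a\<close> onto
  itself.\<close>

lemma inj_on_range_a:
  assumes "f \<in> Reg a" "range a \<subseteq> range (a \<circ> f)"
  shows "inj_on f (range a)"
proof -
  have "a ` f ` range a = a ` range f"
    using assms(1) by (simp add: Reg_iff image_comp)
  then have "(a \<circ> f) ` range a = range a"
    using assms(2) by (auto simp: image_comp)
  then have "inj_on (a \<circ> f) (range a)"
    using finite_range_a by (metis eq_card_imp_inj_on)
  then show ?thesis by (rule inj_on_imageI2)
qed

lemma retractions_nonempty: "n > 0 \<Longrightarrow> retractions \<noteq> {}"
  and sections_nonempty: "sections \<noteq> {}"
proof -
  show "n > 0 \<Longrightarrow> retractions \<noteq> {}"
    using bij_betw_imp_surj_on[OF bij_retractions] by (metis PiE_eq_empty_iff image_empty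
        lessThan_empty_iff bot_nat_0.not_eq_extremum)
  show "sections \<noteq> {}"
    using p_in_range by (force simp: sections_def PiE_eq_empty_iff)
qed

lemma card_sections_le_generators:
  assumes G: "sg_generates (sandwich a) (Reg a) G" "finite G" and "n > 0"
  shows "card sections \<le> card {g \<in> G. inj_on g (range a)}"
proof -
  obtain r where r: "r \<in> retractions" using retractions_nonempty[OF \<open>n > 0\<close>] by blast
  have "\<exists>g\<in>G. range g = t ` {..<n} \<and> inj_on g (range a)" if t: "t \<in> sections" for t
  proof -
    have "r ` UNIV = {..<n}"
      using r retraction_less[OF r] retraction_p[OF r] by (auto simp: image_iff) metis
    then have range: "range (t \<circ> id \<circ> r) = t ` {..<n}"
      by (metis comp_id image_comp)
    moreover have "range a = a ` t ` {..<n}"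
      using p section_p[OF t] by (auto simp: bij_betw_def image_image)
    ultimately have "range a \<subseteq> range (a \<circ> (t \<circ> id \<circ> r))"
      by (metis image_comp subset_refl)
    then obtain g where g: "g \<in> G" "range g = range (t \<circ> id \<circ> r)"
      using generator_same_range[OF G(1) factors_in_Reg[OF r t, of id]] by auto
    have "range a \<subseteq> range (a \<circ> g)"
      using \<open>range a = a ` t ` {..<n}\<close> range g(2) by (metis image_comp subset_refl)
    moreover have "g \<in> Reg a"
      using g(1) G(1) by (auto simp: sg_generates_def)
    ultimately show ?thesis using g range inj_on_range_a by metis
  qed
  then obtain F where F: "\<And>t. t \<in> sections \<Longrightarrow> F t \<in> G \<and> range (F t) = t ` {..<n} \<and> inj_on (F t) (range a)"
    by metis
  have "inj_on F sections"
  proof (rule inj_onI)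
    fix t t' assume t: "t \<in> sections" "t' \<in> sections" and "F t = F t'"
    then have eq: "t ` {..<n} = t' ` {..<n}" using F by metis
    have "t k = t' k" if "k < n" for k
    proof -
      have "t k \<in> t' ` {..<n}" unfolding eq[symmetric] using that by simp
      then obtain j where "j < n" "t k = t' j" by (auto simp only: image_iff lessThan_iff)
      then show ?thesis using that t by (metis p_eq_iff section_p)
    qed
    then show "t = t'" using t by (auto simp: sections_def intro: PiE_ext)
  qed
  then show ?thesis using F G(2) by (intro card_inj_on_le[of F]) auto
qed

text \<open>The dual count by kernels: the kernel of \<open>r\<close> relates \<open>x\<close> to
  \<open>p (r x)\<close>, which determines \<open>r\<close>.\<close>

lemma card_retractions_le_generators:
  assumes G: "sg_generates (sandwich a) (Reg a) G" "finite G"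
  shows "card retractions \<le> card {g \<in> G. inj_on g (range a)}"
proof -
  obtain t where t: "t \<in> sections" using sections_nonempty by blast
  have "\<exists>g\<in>G. (\<forall>x x'. g x = g x' \<longleftrightarrow> r x = r x') \<and> inj_on g (range a)" if r: "r \<in> retractions" for r
  proof -
    have eq: "(t \<circ> id \<circ> r) x = (t \<circ> id \<circ> r) x' \<longleftrightarrow> r x = r x'" for x x'
      using section_p[OF t] retraction_less[OF r] by (metis comp_apply p_eq_iff id_apply)
    have inj: "inj_on r (range a)"
      using retraction_p[OF r] ex_index by (auto simp: inj_on_def) metis
    then have "inj_on (t \<circ> id \<circ> r) (range a)"
      unfolding inj_on_def eq .
    then obtain g where "g \<in> G" "\<forall>x x'. g x = g x' \<longleftrightarrow> r x = r x'"
      using generator_same_kernel[OF G(1) factors_in_Reg[OF r t, of id]] eq by auto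
    then show ?thesis using inj unfolding inj_on_def by metis
  qed
  then obtain F where F: "\<And>r. r \<in> retractions \<Longrightarrow> F r \<in> G \<and> (\<forall>x x'. F r x = F r x' \<longleftrightarrow> r x = r x')
      \<and> inj_on (F r) (range a)"
    by metis
  have "inj_on F retractions"
  proof (rule inj_onI)
    fix r r' assume r: "r \<in> retractions" "r' \<in> retractions" and eq: "F r = F r'"
    show "r = r'"
    proof
      fix x
      have "r x = r (p (r x))" using r by (simp add: retraction_less retraction_p)
      then have "r' x = r' (p (r x))" using F[OF r(1)] F[OF r(2)] eq by metis
      then show "r x = r' x" using r by (simp add: retraction_less retraction_p)
    qed
  qed
  then show ?thesis using F G(2) by (intro card_inj_on_le[of F]) auto
qed

text \<open>Both counts involve only generators injective on \<open>range a\<close>, and at least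
  one further generator is not.\<close>

lemma card_generators_ge:
  assumes G: "sg_generates (sandwich a) (Reg a) G" "finite G" and "n \<ge> 2"
  shows "1 + max (card retractions) (card sections) \<le> card G"
proof -
  have "p 0 \<in> range a" "p 1 \<in> range a" "p 0 \<noteq> p 1"
    using p_in_range[of 0] p_in_range[of 1] p_eq_iff[of 0 1] \<open>n \<ge> 2\<close> by simp_all
  then obtain u v where "a u \<noteq> a v" by (metis rangeE)
  then have "{g \<in> G. inj_on g (range a)} \<subset> G"
    using noninjective_generator[OF G(1)] by blast
  then have "card {g \<in> G. inj_on g (range a)} < card G"
    using G(2) by (intro psubset_card_mono)
  then show ?thesis
    using card_sections_le_generators[OF G] card_retractions_le_generators[OF G] \<open>n \<ge> 2\<close> by auto
qed

section \<open>A generating set of least size\<close>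

text \<open>The triples run through all retractions and all sections. The cycle sits at index 0 and
  the transposition at index 1, which is why \<open>M\<close> has to be at least 2.\<close>

lemma Reg_generated:
  fixes M :: nat
  assumes "n \<ge> 2" "M \<ge> 2" and \<rho>: "\<rho> ` {..<M} = retractions" and \<sigma>: "\<sigma> ` {..<M} = sections"
    and q: "q = (\<lambda>_. id)(0 := \<lambda>k. Suc k mod n, 1 := transpose 0 1)"
    and G: "G = insert (\<sigma> 0 \<circ> id(1 := 0) \<circ> \<rho> 0) ((\<lambda>i. \<sigma> i \<circ> q i \<circ> \<rho> i) ` {..<M})"
  shows "sg_generates (sandwich a) (Reg a) G"
proof -
  let ?T = "sg_generated (sandwich a) G"
  define E where "E = {h. h ` {..<n} \<subseteq> {..<n}}"
  have \<rho>': "\<rho> i \<in> retractions" if "i < M" for i using \<rho> that by blast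
  have \<sigma>': "\<sigma> i \<in> sections" if "i < M" for i using \<sigma> that by blast
  have q_E: "q i \<in> E" for i
    using \<open>n \<ge> 2\<close> by (auto simp: q E_def transpose_def)
  have collapse_E: "id(1 := 0) \<in> E"
    using \<open>n \<ge> 2\<close> by (auto simp: E_def)
  have prod: "sandwich a (t \<circ> h \<circ> r) (t' \<circ> h' \<circ> r') = t' \<circ> (h' \<circ> h) \<circ> r"
    if "r \<in> retractions" "r' \<in> retractions" "t \<in> sections" "h \<in> E" for r r' t t' h h'
    using that by (simp add: sandwich_factors E_def)
  have cong: "t \<circ> h \<circ> r = t \<circ> h' \<circ> r" if "\<And>k. k < n \<Longrightarrow> h k = h' k" "r \<in> retractions" for t h h' r
    using that by (auto simp: retraction_less)
  have pow_E: "(q i ^^ m) \<in> E" for i m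
    by (induction m) (use q_E in \<open>auto simp: E_def image_subset_iff\<close>)
  have q_T: "\<sigma> i \<circ> q i \<circ> \<rho> i \<in> ?T" if "i < M" for i
    using that unfolding G by (intro sg_generated.gen insertI2 imageI) simp
  \<comment> \<open>A semigroup supplies only positive powers, hence the exponent
    \<open>Suc m\<close>.\<close>
  have pow_T: "\<sigma> i \<circ> (q i ^^ Suc m) \<circ> \<rho> i \<in> ?T" if "i < M" for i m
  proof (induction m)
    case 0
    from q_T[OF that] show ?case by (simp add: comp_def)
  next
    case (Suc m)
    from sg_generated.mul[OF Suc q_T[OF that]] show ?case
      unfolding prod[OF \<rho>'[OF that] \<rho>'[OF that] \<sigma>'[OF that] pow_E] by (simp only: funpow.simps)
  qed
  \<comment> \<open>The exponent \<open>n * 2\<close> is a multiple of the order of the cycle and of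
    the order of the transposition.\<close>
  have pow_id: "(q i ^^ (n * 2)) k = k" if "k < n" for i k
  proof -
    have "((\<lambda>k. Suc k mod n) ^^ m) k = (k + m) mod n" for m
      using that by (induction m) (auto simp: mod_Suc_eq)
    moreover have "(transpose 0 1 :: nat \<Rightarrow> nat) ^^ 2 = id"
      by (simp add: numeral_2_eq_2)
    then have "(transpose 0 1 :: nat \<Rightarrow> nat) ^^ (n * 2) = id"
      by (metis funpow_mult id_funpow mult.commute)
    ultimately show ?thesis using that by (auto simp: q)
  qed
  have diag: "\<sigma> i \<circ> id \<circ> \<rho> i \<in> ?T" if "i < M" for i
  proof -
    have "n * 2 = Suc (n * 2 - 1)" using \<open>n \<ge> 2\<close> by simp
    then have "\<sigma> i \<circ> (q i ^^ (n * 2)) \<circ> \<rho> i \<in> ?T"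
      using pow_T[OF that, of "n * 2 - 1"] by simp
    then show ?thesis
      using cong[of "q i ^^ (n * 2)" id, OF _ \<rho>'[OF that]] pow_id by (metis id_apply)
  qed
  have id_E: "id \<in> E" by (simp add: E_def)
  \<comment> \<open>The product of the diagonal elements \<open>i\<close> and \<open>j\<close> takes
    its retraction from \<open>i\<close> and its section from \<open>j\<close>.\<close>
  have band: "t \<circ> id \<circ> r \<in> ?T" if rt: "r \<in> retractions" "t \<in> sections" for r t
  proof -
    obtain i j where ij: "i < M" "j < M" "r = \<rho> i" "t = \<sigma> j"
      using rt \<rho> \<sigma> by force
    show ?thesis
      using sg_generated.mul[OF diag[OF ij(1)] diag[OF ij(2)]]
      unfolding prod[OF \<rho>'[OF ij(1)] \<rho>'[OF ij(2)] \<sigma>'[OF ij(1)] id_E] ij by simp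
  qed
  define Q where "Q = {h \<in> E. \<forall>r\<in>retractions. \<forall>t\<in>sections. t \<circ> h \<circ> r \<in> ?T}"
  \<comment> \<open>Multiplying by band elements on either side replaces \<open>r\<close> and
    \<open>t\<close> at will, so one pair suffices for membership in \<open>Q\<close>.\<close>
  have spread: "h \<in> Q"
    if "h \<in> E" and rt: "r \<in> retractions" "t \<in> sections" and "t \<circ> h \<circ> r \<in> ?T" for h r t
  proof -
    have "t' \<circ> h \<circ> r' \<in> ?T" if rt': "r' \<in> retractions" "t' \<in> sections" for r' t'
    proof -
      have "sandwich a (t \<circ> id \<circ> r') (t \<circ> h \<circ> r) \<in> ?T"
        using band rt rt' \<open>t \<circ> h \<circ> r \<in> ?T\<close> by (intro sg_generated.mul)
      then have "t \<circ> h \<circ> r' \<in> ?T"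
        unfolding prod[OF rt'(1) rt(1) rt(2) id_E] by simp
      then have "sandwich a (t \<circ> h \<circ> r') (t' \<circ> id \<circ> r) \<in> ?T"
        using band rt rt' by (intro sg_generated.mul)
      then show ?thesis
        unfolding prod[OF rt'(1) rt(1) rt(2) \<open>h \<in> E\<close>] by simp
    qed
    then show ?thesis using \<open>h \<in> E\<close> by (simp add: Q_def)
  qed
  obtain r0 t0 where rt0: "r0 \<in> retractions" "t0 \<in> sections"
    using \<rho>'[of 0] \<sigma>'[of 0] \<open>M \<ge> 2\<close> by auto
  have q_Q: "q i \<in> Q" if "i < M" for i
    using spread[OF q_E \<rho>' \<sigma>' q_T] that by blast
  have "h \<in> Q" if "h \<in> E" for h
  proof (rule transformations_generated[OF \<open>n \<ge> 2\<close>])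
    show "h ` {..<n} \<subseteq> {..<n}" using that by (simp add: E_def)
    show "id \<in> Q" using band id_E by (simp add: Q_def)
    show "(\<lambda>k. Suc k mod n) \<in> Q" using q_Q[of 0] \<open>M \<ge> 2\<close> by (simp add: q)
    show "transpose 0 1 \<in> Q" using q_Q[of 1] \<open>M \<ge> 2\<close> by (simp add: q)
    show "id(1 := 0) \<in> Q"
      using \<open>M \<ge> 2\<close> by (intro spread[OF collapse_E \<rho>'[of 0] \<sigma>'[of 0]])
        (simp_all add: G sg_generated.gen)
    show "g \<circ> h \<in> Q" if "g \<in> Q" "h \<in> Q" for g h
    proof -
      have "g \<circ> h \<in> E" using that by (auto simp: Q_def E_def image_subset_iff)
      moreover have "t0 \<circ> (g \<circ> h) \<circ> r0 \<in> ?T"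
      proof -
        have "h \<in> E" using that by (simp add: Q_def)
        moreover have "sandwich a (t0 \<circ> h \<circ> r0) (t0 \<circ> g \<circ> r0) \<in> ?T"
          using that rt0 unfolding Q_def by (blast intro: sg_generated.mul)
        ultimately show ?thesis using prod[OF rt0(1) rt0(1) rt0(2)] by metis
      qed
      ultimately show ?thesis using spread rt0 by blast
    qed
    show "h \<in> Q" if "g \<in> Q" and eq: "\<And>k. k < n \<Longrightarrow> g k = h k" for g h
    proof -
      have "h \<in> E" using that by (auto simp: Q_def E_def image_subset_iff)
      moreover have "t0 \<circ> h \<circ> r0 \<in> ?T"
        using \<open>g \<in> Q\<close> rt0 unfolding Q_def by (simp only: mem_Collect_eq flip: cong[OF eq rt0(1)])
      ultimately show ?thesis using spread rt0 by blast
    qed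
  qed
  then have "Reg a \<subseteq> ?T"
    using factors_exist by (fastforce simp: Q_def E_def)
  moreover have GR: "G \<subseteq> Reg a"
    using factors_in_Reg[OF \<rho>' \<sigma>'] q_E collapse_E \<open>M \<ge> 2\<close> by (auto simp: G E_def)
  moreover have "?T \<subseteq> Reg a"
  proof
    fix f assume "f \<in> ?T"
    then show "f \<in> Reg a"
      by induction (use GR in \<open>auto intro: sandwich_in_Reg\<close>)
  qed
  ultimately show ?thesis by (auto simp: sg_generates_def)
qed

text \<open>If both numbers were at most 1, the first would force \<open>a\<close> to be surjective
  and the second would make every fibre a singleton, so \<open>a\<close> would be bijective.\<close>

lemma two_le_max_card:
  assumes "\<not> bij a" "n \<ge> 2" and X: "finite (UNIV :: 'x set)" and Y: "finite (UNIV :: 'y set)"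
  shows "2 \<le> max (card retractions) (card sections)"
proof (rule ccontr)
  assume neg: "\<not> ?thesis"
  have fin: "finite (a -` {p k})" for k by (rule finite_subset[OF subset_UNIV Y])
  have pos: "card (a -` {p k}) \<ge> 1" if "k < n" for k
    using p_in_range[OF that] fin[of k] by (auto simp: Suc_le_eq card_gt_0_iff)
  have "card (UNIV - range a) = 0"
  proof (rule ccontr)
    assume "card (UNIV - range a) \<noteq> 0"
    then have "n ^ 1 \<le> n ^ card (UNIV - range a)"
      using \<open>n \<ge> 2\<close> by (intro power_increasing) auto
    then show False using neg card_retractions[OF X] \<open>n \<ge> 2\<close> by simp
  qed
  then have "surj a" using X finite_subset by auto
  have "(\<Prod>k<n. card (a -` {p k})) = 1"
    using neg pos prod_ge_1[of "{..<n}" "\<lambda>k. card (a -` {p k})"] by (simp add: card_sections)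
  then have one: "card (a -` {p k}) = 1" if "k < n" for k
    using that prod_eq_1_iff[of "{..<n}" "\<lambda>k. card (a -` {p k})"] by simp
  have "inj a"
  proof (rule injI)
    fix y y' assume "a y = a y'"
    moreover obtain k where "k < n" "p k = a y" using ex_index by blast
    ultimately show "y = y'"
      using one[of k] card_1_singletonE[of "a -` {p k}"] by (metis singletonD vimage_singleton_eq)
  qed
  then show False using \<open>surj a\<close> assms(1) by (simp add: bij_def)
qed

lemma sg_rank_Reg_finite:
  assumes "\<not> bij a" "n \<ge> 2" and X: "finite (UNIV :: 'x set)" and Y: "finite (UNIV :: 'y set)"
    and "finite (Reg a)"
  shows "sg_rank (sandwich a) (Reg a) =o |{..<1 + max (card retractions) (card sections)}|"
proof -
  define M where "M = max (card retractions) (card sections)"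
  have "M \<ge> 2" unfolding M_def using assms(1,2) X Y by (rule two_le_max_card)
  have "finite retractions"
    using card_retractions[OF X] \<open>n \<ge> 2\<close> by (intro card_ge_0_finite) simp
  then obtain \<rho> where \<rho>: "\<rho> ` {..<M} = retractions"
    using ex_surj_lessThan[OF _ retractions_nonempty, of M] \<open>n \<ge> 2\<close> M_def
    by (metis max.cobounded1 not_numeral_le_zero bot_nat_0.not_eq_extremum)
  have "finite sections"
    unfolding sections_def using finite_subset[OF subset_UNIV Y] by (intro finite_PiE) auto
  then obtain \<sigma> where \<sigma>: "\<sigma> ` {..<M} = sections"
    using ex_surj_lessThan[OF _ sections_nonempty, of M] M_def by (metis max.cobounded2)
  define q :: "nat \<Rightarrow> nat \<Rightarrow> nat" where "q = (\<lambda>_. id)(0 := \<lambda>k. Suc k mod n, 1 := transpose 0 1)"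
  define H where "H = insert (\<sigma> 0 \<circ> id(1 := 0) \<circ> \<rho> 0) ((\<lambda>i. \<sigma> i \<circ> q i \<circ> \<rho> i) ` {..<M})"
  \<comment> \<open>An upper estimate is enough: coinciding elements only shrink \<open>H\<close>,
    and the lower bound holds for every generating set.\<close>
  have "card H \<le> Suc (card ((\<lambda>i. \<sigma> i \<circ> q i \<circ> \<rho> i) ` {..<M}))"
    unfolding H_def by (rule card_insert_le_m1) auto
  also have "\<dots> \<le> 1 + M"
    using card_image_le[of "{..<M}"] by simp
  finally have "card H \<le> 1 + M" .
  moreover have "sg_generates (sandwich a) (Reg a) H"
    using Reg_generated[OF \<open>n \<ge> 2\<close> \<open>M \<ge> 2\<close> \<rho> \<sigma> q_def H_def] .
  moreover have "1 + M \<le> card K" if "sg_generates (sandwich a) (Reg a) K" for K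
    using card_generators_ge[OF that _ \<open>n \<ge> 2\<close>] that \<open>finite (Reg a)\<close>
    unfolding M_def sg_generates_def by (metis finite_subset)
  ultimately show ?thesis
    unfolding M_def[symmetric] using \<open>finite (Reg a)\<close> sandwich_in_Reg
    by (intro sg_rank_finite) auto
qed

end

section \<open>The rank formula assembled from its cases\<close>

theorem theorem3p7:
  fixes a :: "'y \<Rightarrow> 'x" and I :: "'i set" and ai :: "'i \<Rightarrow> 'x"
  assumes "\<not> bij a"
    and "inj_on ai I"
    and "range a = ai ` I"
  shows "(infinite (Reg a) \<longrightarrow> sg_rank (sandwich a) (Reg a) =o |Reg a| ) \<and>
    (finite (Reg a) \<longrightarrow>
      (let \<alpha> = card (range a);
           \<beta> = card (UNIV - range a);
           \<Lambda> = (\<Prod>i\<in>I. card (a -` {ai i}))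
       in (\<alpha> = 1 \<and> finite (UNIV :: 'y set) \<or>
           \<alpha> \<ge> 2 \<and> finite (UNIV :: 'x set) \<and> (\<forall>i\<in>I. finite (a -` {ai i}))) \<and>
          (\<alpha> = 1 \<longrightarrow> sg_rank (sandwich a) (Reg a) =o |UNIV :: 'y set| ) \<and>
          (\<alpha> \<ge> 2 \<longrightarrow> sg_rank (sandwich a) (Reg a) =o |{..<1 + max (\<alpha> ^ \<beta>) \<Lambda>}| )))"
proof (intro conjI impI)
  assume "infinite (Reg a)"
  then show "sg_rank (sandwich a) (Reg a) =o |Reg a|" by (rule sg_rank_Reg_infinite)
next
  assume fin: "finite (Reg a)"
  \<comment> \<open>The constant maps embed the codomain into the finite semigroup.\<close>
  have "inj (\<lambda>y (_ :: 'x). y :: 'y)" by (auto simp: inj_def fun_eq_iff)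
  moreover have "range (\<lambda>y (_ :: 'x). y :: 'y) \<subseteq> Reg a" by (auto intro: const_in_Reg)
  ultimately have Y: "finite (UNIV :: 'y set)"
    using fin finite_subset finite_imageD by metis
  obtain G where "sg_generates (sandwich a) (Reg a) G"
    using sg_rank_least(1)[of "Reg a" "sandwich a"] sandwich_in_Reg by blast
  moreover have "finite G"
    using calculation fin by (auto simp: sg_generates_def intro: finite_subset)
  ultimately have X: "finite (UNIV :: 'x set)" if "a u \<noteq> a v" for u v
    using finite_domain_if_finite_generators[of a G u v] Y that by simp
  have const: "sg_rank (sandwich a) (Reg a) =o |UNIV :: 'y set|" if "card (range a) = 1"
    using that by (intro sg_rank_Reg_const) (metis card_1_singletonE rangeI singletonD)
  have XX: "finite (UNIV :: 'x set)" if "card (range a) \<ge> 2"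
  proof -
    have "\<exists>u v. a u \<noteq> a v"
    proof (rule ccontr)
      assume "\<not> ?thesis"
      then have "range a = {a undefined}" by auto
      then show False using that by simp
    qed
    then show ?thesis using X by blast
  qed
  have big: "sg_rank (sandwich a) (Reg a) =o |{..<1 + max (card (range a) ^ card (UNIV - range a))
      (\<Prod>i\<in>I. card (a -` {ai i}))}|" if two: "card (range a) \<ge> 2"
  proof -
    obtain p where "bij_betw p {..<card (range a)} (range a)"
      using ex_bij_betw_nat_finite[of "range a"] Y by (auto simp: atLeast0LessThan)
    then interpret rank_coordinates a p "card (range a)" by unfold_locales
    \<comment> \<open>The fibre product is reindexed from the numbering \<open>p\<close> to
      \<open>range a\<close>, and from there to \<open>I\<close>.\<close>
    have "card sections = (\<Prod>x\<in>range a. card (a -` {x}))"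
      unfolding card_sections by (rule prod.reindex_bij_betw[OF p])
    also have "\<dots> = (\<Prod>i\<in>I. card (a -` {ai i}))"
      unfolding assms(3) by (simp add: prod.reindex[OF assms(2)])
    finally show ?thesis
      using sg_rank_Reg_finite[OF assms(1) two XX[OF two] Y fin] card_retractions[OF XX[OF two]] by simp
  qed
  have "card (range a) > 0" using Y by (simp add: card_gt_0_iff)
  then have "card (range a) = 1 \<or> card (range a) \<ge> 2" by linarith
  moreover have "finite (a -` {x})" for x by (rule finite_subset[OF subset_UNIV Y])
  ultimately have shape: "card (range a) = 1 \<and> finite (UNIV :: 'y set) \<or>
      card (range a) \<ge> 2 \<and> finite (UNIV :: 'x set) \<and> (\<forall>i\<in>I. finite (a -` {ai i}))"
    using XX Y by blast
  show "let \<alpha> = card (range a);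
           \<beta> = card (UNIV - range a);
           \<Lambda> = (\<Prod>i\<in>I. card (a -` {ai i}))
       in (\<alpha> = 1 \<and> finite (UNIV :: 'y set) \<or>
           \<alpha> \<ge> 2 \<and> finite (UNIV :: 'x set) \<and> (\<forall>i\<in>I. finite (a -` {ai i}))) \<and>
          (\<alpha> = 1 \<longrightarrow> sg_rank (sandwich a) (Reg a) =o |UNIV :: 'y set| ) \<and>
          (\<alpha> \<ge> 2 \<longrightarrow> sg_rank (sandwich a) (Reg a) =o |{..<1 + max (\<alpha> ^ \<beta>) \<Lambda>}| )"
    unfolding Let_def by (intro conjI impI shape const big)
qed

end
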